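(* For every integer $m\geq 2$ and every real $p$ with $2m\leq p<\infty$, the optimal constant $H_{\mathbb{R},m,p}^{\mathrm{pol}}$ of the real polynomial Hardy--Littlewood inequality satisfies $$\left(\sqrt[16]{2}\right)^{m}\leq 2^{\frac{mp+p-6m+4}{4p}\cdot\frac{m-1}{m}}\leq H_{\mathbb{R},m,p}^{\mathrm{pol}}.$$
   Context: For $n\ge 1$, $\ell_p^n$ over $\mathbb{R}$ is $\mathbb{R}^n$ with the $\ell_p$ norm. An $m$-homogeneous polynomial on $\ell_p^n$ is written $P(x_1,\ldots,x_n)=\sum_{|\alpha|=m}a_\alpha x^\alpha$, where $\alpha=(\alpha_1,\ldots,\alpha_n)$ ranges over $n$-tuples of nonnegative integers, $|\alpha|=\alpha_1+\cdots+\alpha_n$, $x^\alpha=x_1^{\alpha_1}\cdots x_n^{\alpha_n}$ and $a_\alpha\in\mathbb{R}$. Its norm is $\|P\|=\sup\{|P(x)|: \|x\|_{\ell_p^n}\le 1\}$. For $m\ge 2$ and $p\ge 2m$, $H_{\mathbb{R},m,p}^{\mathrm{pol}}$ denotes the optimal (smallest) constant $H$ such that $$\left(\sum_{|\alpha|=m}|a_\alpha|^{\frac{2mp}{mp+p-2m}}\right)^{\frac{mp+p-2m}{2mp}}\leq H\,\|P\|$$ for all positive integers $n$ and all $m$-homogeneous polynomials $P=\sum_{|\alpha|=m}a_\alpha x^\alpha$ on the real space $\ell_p^n$. (Such a finite constant, independent of $n$, is known to exist.) *)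

theory Defs
  imports Complex_Main "HOL-Library.Extended_Real"
begin

text \<open>
  Since the inequality quantifies over the dimension \<open>n\<close>, points of \<open>n\<close>-dimensional real space are
  represented by functions \<open>nat \<Rightarrow> real\<close> of which only the coordinates \<open>i < n\<close> are ever inspected.
\<close>

definition lp_norm :: "nat \<Rightarrow> real \<Rightarrow> (nat \<Rightarrow> real) \<Rightarrow> real" where
  "lp_norm n p x = (\<Sum>i<n. \<bar>x i\<bar> powr p) powr (1 / p)"

text \<open>
  Multi-indices vanish outside \<open>{..<n}\<close>, so that distinct functions are distinct \<open>n\<close>-tuples.
\<close>

definition multi_indices :: "nat \<Rightarrow> nat \<Rightarrow> (nat \<Rightarrow> nat) set" where
  "multi_indices n m = {\<alpha>. (\<forall>i\<ge>n. \<alpha> i = 0) \<and> (\<Sum>i<n. \<alpha> i) = m}"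

text \<open>
  An \<open>m\<close>-homogeneous polynomial in \<open>n\<close> variables is given by its coefficient family \<open>a\<close>, of which
  only the values on \<^term>\<open>multi_indices n m\<close> matter.
\<close>

definition hpoly :: "nat \<Rightarrow> nat \<Rightarrow> ((nat \<Rightarrow> nat) \<Rightarrow> real) \<Rightarrow> (nat \<Rightarrow> real) \<Rightarrow> real" where
  "hpoly n m a x = (\<Sum>\<alpha>\<in>multi_indices n m. a \<alpha> * (\<Prod>i<n. x i ^ \<alpha> i))"

definition hpoly_norm :: "nat \<Rightarrow> nat \<Rightarrow> real \<Rightarrow> ((nat \<Rightarrow> nat) \<Rightarrow> real) \<Rightarrow> real" where
  "hpoly_norm n m p a = (SUP x\<in>{x. lp_norm n p x \<le> 1}. \<bar>hpoly n m a x\<bar>)"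

definition is_HL_const :: "nat \<Rightarrow> real \<Rightarrow> real \<Rightarrow> bool" where
  "is_HL_const m p H \<longleftrightarrow>
     (\<forall>n\<ge>1. \<forall>a.
        (\<Sum>\<alpha>\<in>multi_indices n m.
            \<bar>a \<alpha>\<bar> powr (2 * real m * p / (real m * p + p - 2 * real m)))
          powr ((real m * p + p - 2 * real m) / (2 * real m * p))
        \<le> H * hpoly_norm n m p a)"

text \<open>
  The infimum is taken in the extended reals, so the definition does not presuppose that an
  admissible constant exists; when one exists, this is the smallest one.
\<close>

definition HL_pol_const :: "nat \<Rightarrow> real \<Rightarrow> ereal" where
  "HL_pol_const m p = Inf (ereal ` {H. is_HL_const m p H})"

text \<open>
  The sums over multi-indices are finite, and the supremum defining \<^const>\<open>hpoly_norm\<close> is that of a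
  nonempty bounded set, so neither takes an unintended default value.
\<close>

lemma finite_multi_indices: "finite (multi_indices n m)"
proof (rule finite_subset)
  show "multi_indices n m \<subseteq> {\<alpha>. \<forall>i. (i \<in> {..<n} \<longrightarrow> \<alpha> i \<in> {..m}) \<and> (i \<notin> {..<n} \<longrightarrow> \<alpha> i = 0)}"
    unfolding multi_indices_def by (auto intro: member_le_sum)
  show "finite {\<alpha>. \<forall>i. (i \<in> {..<n} \<longrightarrow> \<alpha> i \<in> {..m}) \<and> (i \<notin> {..<n} \<longrightarrow> \<alpha> i = (0::nat))}"
    by (rule finite_set_of_finite_funs) auto
qed

lemma lp_norm_zero: "lp_norm n p (\<lambda>_. 0) \<le> 1"
  by (simp add: lp_norm_def)

lemma lp_ball_coord_le_1:
  assumes "p > 0" "lp_norm n p x \<le> 1" "i < n"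
  shows "\<bar>x i\<bar> \<le> 1"
proof (rule ccontr)
  assume "\<not> \<bar>x i\<bar> \<le> 1"
  then have "1 < \<bar>x i\<bar> powr p"
    using assms(1) by (simp add: gr_one_powr)
  also have "\<dots> \<le> (\<Sum>i<n. \<bar>x i\<bar> powr p)"
    using assms(3) by (intro member_le_sum) auto
  finally have "1 < (\<Sum>i<n. \<bar>x i\<bar> powr p) powr (1 / p)"
    using assms(1) by (intro gr_one_powr) auto
  with assms(2) show False
    by (simp add: lp_norm_def)
qed

lemma bdd_above_hpoly:
  assumes "p > 0"
  shows "bdd_above ((\<lambda>x. \<bar>hpoly n m a x\<bar>) ` {x. lp_norm n p x \<le> 1})"
proof (rule bdd_aboveI2)
  fix x assume "x \<in> {x. lp_norm n p x \<le> 1}"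
  then have x: "\<bar>x i\<bar> \<le> 1" if "i < n" for i
    using lp_ball_coord_le_1[OF assms _ that] by simp
  have "\<bar>hpoly n m a x\<bar> \<le> (\<Sum>\<alpha>\<in>multi_indices n m. \<bar>a \<alpha> * (\<Prod>i<n. x i ^ \<alpha> i)\<bar>)"
    unfolding hpoly_def by (rule sum_abs)
  also have "\<dots> \<le> (\<Sum>\<alpha>\<in>multi_indices n m. \<bar>a \<alpha>\<bar>)"
  proof (rule sum_mono)
    fix \<alpha>
    have "(\<Prod>i<n. \<bar>x i\<bar> ^ \<alpha> i) \<le> 1"
      using x by (intro prod_le_1) (auto intro: power_le_one)
    then show "\<bar>a \<alpha> * (\<Prod>i<n. x i ^ \<alpha> i)\<bar> \<le> \<bar>a \<alpha>\<bar>"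
      by (simp add: abs_mult abs_prod power_abs mult_left_le)
  qed
  finally show "\<bar>hpoly n m a x\<bar> \<le> (\<Sum>\<alpha>\<in>multi_indices n m. \<bar>a \<alpha>\<bar>)" .
qed

end

theory Submission
  imports Defs
begin

text \<open>
  With \<open>k = m div 2\<close>, the polynomial \<open>z\<^bsup>m - 2k\<^esup> (x\<^sub>1\<^sup>2 - y\<^sub>1\<^sup>2) \<dots> (x\<^sub>k\<^sup>2 - y\<^sub>k\<^sup>2)\<close>
  has norm at most 1 and \<open>2\<^sup>k\<close> coefficients, all equal to 1 or -1. It therefore forces the
  Hardy--Littlewood constant to be at least \<open>2\<^bsup>k/s\<^esup>\<close>, where \<open>s = 2mp / (mp + p - 2m)\<close>, and
  \<open>k \<ge> (m - 1) / 2\<close> makes this at least the claimed bound.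
\<close>

text \<open>
  The variables \<open>x\<^sub>i\<close>, \<open>y\<^sub>i\<close>, \<open>z\<close> have the numbers \<open>i\<close>, \<open>k + i\<close>, \<open>2 * k\<close>. The set \<open>A\<close> records the
  factors from which \<open>x\<^sub>i\<^sup>2\<close> is picked when the product is expanded.
\<close>

definition diff_index :: "nat \<Rightarrow> nat \<Rightarrow> nat set \<Rightarrow> nat \<Rightarrow> nat" where
  "diff_index m k A i =
     (if i < k then (if i \<in> A then 2 else 0)
      else if i < 2 * k then (if i - k \<in> A then 0 else 2)
      else if i = 2 * k then m - 2 * k else 0)"

text \<open>For \<open>i < k\<close> the exponent of \<open>x\<^sub>i\<close> is 0 exactly when
  \<open>- y\<^sub>i\<^sup>2\<close> was picked from factor \<open>i\<close>, so the product over
  \<open>i\<close> recovers the sign of the monomial from its exponents alone.\<close>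

definition diff_coeff :: "nat \<Rightarrow> nat \<Rightarrow> (nat \<Rightarrow> nat) \<Rightarrow> real" where
  "diff_coeff m k \<alpha> =
     (if \<alpha> \<in> diff_index m k ` Pow {..<k} then \<Prod>i<k. if \<alpha> i = 0 then -1 else 1 else 0)"

lemma lessThan_double_Suc_split:
  "{..<2 * k + 1} = insert (2 * k) ({..<k} \<union> (+) k ` {..<k})" for k :: nat
proof -
  have "(+) k ` {..<k} = {k..<2 * k}"
    using image_add_atLeastLessThan[of k 0 k] by (simp add: lessThan_atLeast0 mult_2)
  then show ?thesis
    by auto
qed

text \<open>Stated for a commutative monoid so that it serves both the sum of the exponents and the
  product of the powers.\<close>

lemma (in comm_monoid_set) lessThan_double_Suc:
  "F g {..<2 * k + 1} = f (g (2 * k)) (F (\<lambda>i. f (g i) (g (k + i))) {..<k})" for k :: nat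
proof -
  have "F g {..<2 * k + 1} = f (g (2 * k)) (F g ({..<k} \<union> (+) k ` {..<k}))"
    unfolding lessThan_double_Suc_split by (subst insert) auto
  also have "F g ({..<k} \<union> (+) k ` {..<k}) = f (F g {..<k}) (F g ((+) k ` {..<k}))"
    by (intro union_disjoint) auto
  also have "F g ((+) k ` {..<k}) = F (\<lambda>i. g (k + i)) {..<k}"
    by (subst reindex) (auto simp: inj_on_def o_def)
  finally show ?thesis
    by (simp add: distrib)
qed

lemma inj_on_diff_index: "inj_on (diff_index m k) (Pow {..<k})"
proof (rule inj_onI)
  fix A B assume A: "A \<in> Pow {..<k}" and B: "B \<in> Pow {..<k}"
    and eq: "diff_index m k A = diff_index m k B"
  have "i \<in> A \<longleftrightarrow> i \<in> B" if "i < k" for i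
    using fun_cong[OF eq, of i] that by (auto simp: diff_index_def split: if_splits)
  then show "A = B"
    using A B by auto
qed

text \<open>Each factor contributes degree 2 whichever square is picked, and \<open>z\<close> makes
  up the rest; the assumption keeps \<open>m - 2 * k\<close> from being truncated.\<close>

lemma diff_index_in_multi_indices:
  assumes "2 * k \<le> m"
  shows "diff_index m k A \<in> multi_indices (2 * k + 1) m"
proof -
  have "(\<Sum>i<2 * k + 1. diff_index m k A i) = (m - 2 * k) + (\<Sum>i<k. 2)"
    unfolding sum.lessThan_double_Suc
    by (intro arg_cong2[where f = "(+)"] sum.cong) (auto simp: diff_index_def)
  then show ?thesis
    using assms by (auto simp: multi_indices_def diff_index_def)
qed

lemma diff_coeff_diff_index:
  assumes "A \<subseteq> {..<k}"
  shows "diff_coeff m k (diff_index m k A) = (\<Prod>i<k. if i \<in> A then 1 else -1)"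
  using assms unfolding diff_coeff_def
  by (auto intro!: prod.cong simp: diff_index_def)

lemma abs_diff_coeff_diff_index:
  assumes "A \<subseteq> {..<k}"
  shows "\<bar>diff_coeff m k (diff_index m k A)\<bar> = 1"
  unfolding diff_coeff_diff_index[OF assms] abs_prod by (intro prod.neutral) auto

text \<open>Reduces both the value of the polynomial and the sum of powers of its coefficients to
  sums over the \<open>2 ^ k\<close> choices \<open>A\<close>.\<close>

lemma sum_multi_indices_diff:
  assumes "2 * k \<le> m" and "\<And>\<alpha>. diff_coeff m k \<alpha> = 0 \<Longrightarrow> f \<alpha> = 0"
  shows "(\<Sum>\<alpha>\<in>multi_indices (2 * k + 1) m. f \<alpha>) = (\<Sum>A\<in>Pow {..<k}. f (diff_index m k A))"
proof -
  have "(\<Sum>\<alpha>\<in>multi_indices (2 * k + 1) m. f \<alpha>) = (\<Sum>\<alpha>\<in>diff_index m k ` Pow {..<k}. f \<alpha>)"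
  proof (rule sum.mono_neutral_right)
    show "diff_index m k ` Pow {..<k} \<subseteq> multi_indices (2 * k + 1) m"
      using diff_index_in_multi_indices[OF assms(1)] by blast
    show "\<forall>\<alpha>\<in>multi_indices (2 * k + 1) m - diff_index m k ` Pow {..<k}. f \<alpha> = 0"
      by (auto intro!: assms(2) simp: diff_coeff_def)
  qed (rule finite_multi_indices)
  then show ?thesis
    by (simp add: sum.reindex[OF inj_on_diff_index])
qed

text \<open>By induction: the subsets of \<open>insert j I\<close> that omit \<open>j\<close>
  contribute the factor \<open>- g j\<close>, those that contain it the factor
  \<open>f j\<close>.\<close>

lemma prod_diff_expand:
  fixes f g :: "'a \<Rightarrow> 'b::comm_ring_1"
  assumes "finite I"
  shows "(\<Prod>i\<in>I. f i - g i) = (\<Sum>A\<in>Pow I. \<Prod>i\<in>I. if i \<in> A then f i else - g i)"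
  using assms
proof (induction I rule: finite_induct)
  case (insert j I)
  have *: "(\<Prod>i\<in>insert j I. if i \<in> insert j A then f i else - g i)
             = f j * (\<Prod>i\<in>I. if i \<in> A then f i else - g i)"
    "(\<Prod>i\<in>insert j I. if i \<in> A then f i else - g i)
             = - g j * (\<Prod>i\<in>I. if i \<in> A then f i else - g i)" if "A \<in> Pow I" for A
    using insert.hyps that by (auto intro!: arg_cong2[where f = "(*)"] arg_cong[where f = uminus] prod.cong)
  have inj: "inj_on (insert j) (Pow I)"
    using insert.hyps by (auto simp: inj_on_def)
  have "(\<Sum>A\<in>Pow (insert j I). \<Prod>i\<in>insert j I. if i \<in> A then f i else - g i)
      = (\<Sum>A\<in>Pow I. - g j * (\<Prod>i\<in>I. if i \<in> A then f i else - g i))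
        + (\<Sum>A\<in>Pow I. f j * (\<Prod>i\<in>I. if i \<in> A then f i else - g i))"
    unfolding Pow_insert using insert.hyps
    by (subst sum.union_disjoint)
       (auto simp: sum.reindex[OF inj] *(2) simp del: prod.insert insert_iff intro!: sum.cong *(1))
  then show ?case
    using insert by (simp add: sum_distrib_left[symmetric] sum_negf algebra_simps)
qed simp

lemma hpoly_diff:
  assumes "2 * k \<le> m"
  shows "hpoly (2 * k + 1) m (diff_coeff m k) x
           = x (2 * k) ^ (m - 2 * k) * (\<Prod>i<k. (x i)\<^sup>2 - (x (k + i))\<^sup>2)"
proof -
  have "diff_coeff m k (diff_index m k A) * (\<Prod>i<2 * k + 1. x i ^ diff_index m k A i)
      = x (2 * k) ^ (m - 2 * k) * (\<Prod>i<k. if i \<in> A then (x i)\<^sup>2 else - (x (k + i))\<^sup>2)"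
    if "A \<subseteq> {..<k}" for A
  proof -
    have "(\<Prod>i<2 * k + 1. x i ^ diff_index m k A i)
        = x (2 * k) ^ (m - 2 * k) * (\<Prod>i<k. if i \<in> A then (x i)\<^sup>2 else (x (k + i))\<^sup>2)"
      unfolding prod.lessThan_double_Suc
      by (intro arg_cong2[where f = "(*)"] prod.cong) (auto simp: diff_index_def)
    \<comment> \<open>The coefficient is distributed over the factors, one sign for each
      \<open>y\<^sub>i\<^sup>2\<close>, to match the terms of
      \<open>prod_diff_expand\<close>.\<close>
    moreover have "(\<Prod>i<k. if i \<in> A then 1 else -1) * (\<Prod>i<k. if i \<in> A then (x i)\<^sup>2 else (x (k + i))\<^sup>2)
        = (\<Prod>i<k. if i \<in> A then (x i)\<^sup>2 else - (x (k + i))\<^sup>2)"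
      unfolding prod.distrib[symmetric] by (intro prod.cong) auto
    ultimately show ?thesis
      unfolding diff_coeff_diff_index[OF that] by (simp add: mult.left_commute[of "\<Prod>i<k. if i \<in> A then 1 else -1"])
  qed
  then show ?thesis
    unfolding hpoly_def
    by (subst sum_multi_indices_diff[OF assms])
       (auto simp: prod_diff_expand sum_distrib_left intro!: sum.cong)
qed

text \<open>On the unit ball all coordinates lie in \<open>[-1, 1]\<close>, so each factor is a
  difference of two numbers in \<open>[0, 1]\<close>.\<close>

lemma hpoly_norm_diff_le_1:
  assumes "2 * k \<le> m" and "p > 0"
  shows "hpoly_norm (2 * k + 1) m p (diff_coeff m k) \<le> 1"
  unfolding hpoly_norm_def
proof (rule cSUP_least)
  show "{x. lp_norm (2 * k + 1) p x \<le> 1} \<noteq> {}"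
    using lp_norm_zero by blast
next
  fix x assume "x \<in> {x. lp_norm (2 * k + 1) p x \<le> 1}"
  then have x: "\<bar>x i\<bar> \<le> 1" if "i \<le> 2 * k" for i
    using lp_ball_coord_le_1[OF assms(2), of "2 * k + 1" x i] that by simp
  have "\<bar>(x i)\<^sup>2 - (x (k + i))\<^sup>2\<bar> \<le> 1" if "i < k" for i
  proof -
    have "(x i)\<^sup>2 \<le> 1" "(x (k + i))\<^sup>2 \<le> 1"
      using x[of i] x[of "k + i"] that by (auto simp: abs_square_le_1)
    then show ?thesis
      using zero_le_power2[of "x i"] zero_le_power2[of "x (k + i)"] by linarith
  qed
  then have "(\<Prod>i<k. \<bar>(x i)\<^sup>2 - (x (k + i))\<^sup>2\<bar>) \<le> 1"
    by (intro prod_le_1) auto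
  moreover have "\<bar>x (2 * k)\<bar> ^ (m - 2 * k) \<le> 1"
    using x by (intro power_le_one) auto
  ultimately show "\<bar>hpoly (2 * k + 1) m (diff_coeff m k) x\<bar> \<le> 1"
    unfolding hpoly_diff[OF assms(1)] abs_mult power_abs abs_prod
    by (intro mult_le_one prod_nonneg) auto
qed

lemma hpoly_norm_nonneg:
  assumes "p > 0"
  shows "hpoly_norm n m p a \<ge> 0"
proof -
  have "0 \<le> \<bar>hpoly n m a (\<lambda>_. 0)\<bar>"
    by simp
  also have "\<dots> \<le> hpoly_norm n m p a"
    unfolding hpoly_norm_def
    using lp_norm_zero by (intro cSUP_upper bdd_above_hpoly assms) auto
  finally show ?thesis .
qed

lemma HL_const_ge:
  assumes "is_HL_const m p H" and "2 * k \<le> m" and "p > 0"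
  shows "2 powr (real k * ((real m * p + p - 2 * real m) / (2 * real m * p))) \<le> H"
    (is "2 powr (_ * ?t) \<le> _")
proof -
  define N where "N = hpoly_norm (2 * k + 1) m p (diff_coeff m k)"
  have N: "0 \<le> N" "N \<le> 1"
    unfolding N_def using hpoly_norm_nonneg[OF assms(3)] hpoly_norm_diff_le_1[OF assms(2,3)] by auto
  have "(\<Sum>\<alpha>\<in>multi_indices (2 * k + 1) m.
           \<bar>diff_coeff m k \<alpha>\<bar> powr (2 * real m * p / (real m * p + p - 2 * real m))) powr ?t \<le> H * N"
    using assms(1) unfolding is_HL_const_def N_def by simp
  \<comment> \<open>Since \<open>0 powr s = 0\<close>, only the \<open>2 ^ k\<close> coefficients of
    absolute value 1 count.\<close>
  moreover have "(\<Sum>\<alpha>\<in>multi_indices (2 * k + 1) m.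
           \<bar>diff_coeff m k \<alpha>\<bar> powr (2 * real m * p / (real m * p + p - 2 * real m))) = 2 ^ k"
    by (subst sum_multi_indices_diff[OF assms(2)]) (auto simp: abs_diff_coeff_diff_index card_Pow)
  ultimately have *: "2 powr (real k * ?t) \<le> H * N"
    by (simp add: powr_powr flip: powr_realpow)
  \<comment> \<open>The sign of \<open>H\<close> is not given in advance: it follows from
    \<open>H * N > 0\<close> and \<open>N \<ge> 0\<close>, and then \<open>N \<le> 1\<close> yields
    \<open>H * N \<le> H\<close>.\<close>
  then have "0 < H * N"
    by (rule less_le_trans[rotated]) simp
  then have "H * N \<le> H"
    using N by (intro mult_left_le) (auto simp: zero_less_mult_iff)
  with * show ?thesis
    by linarith
qed

lemma HL_exponent_le:
  fixes m :: nat and p :: real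
  assumes "m \<ge> 2" and "2 * real m \<le> p"
  shows "(real m * p + p - 6 * real m + 4) / (4 * p) * ((real m - 1) / real m)
           \<le> real (m div 2) * ((real m * p + p - 2 * real m) / (2 * real m * p))"
proof -
  have p: "p > 0" and m: "real m \<ge> 2"
    using assms by linarith+
  have "2 * real m \<le> real m * p + p"
    using assms m p mult_nonneg_nonneg[of "real m" p] by linarith
  \<comment> \<open>The numerator grows by \<open>4 * m - 4\<close>, which is nonnegative.\<close>
  have "(real m * p + p - 6 * real m + 4) / (4 * p) * ((real m - 1) / real m)
      \<le> (real m * p + p - 2 * real m) / (4 * p) * ((real m - 1) / real m)"
    using p m by (intro mult_right_mono divide_right_mono) auto
  also have "\<dots> = (real m - 1) / 2 * ((real m * p + p - 2 * real m) / (2 * real m * p))"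
    using p m by (simp add: field_simps)
  also have "\<dots> \<le> real (m div 2) * ((real m * p + p - 2 * real m) / (2 * real m * p))"
  proof (rule mult_right_mono)
    show "(real m - 1) / 2 \<le> real (m div 2)"
      using of_nat_mono[of m "2 * (m div 2) + 1", where 'a = real] by simp
  qed (use p m \<open>2 * real m \<le> real m * p + p\<close> in simp)
  finally show ?thesis .
qed

lemma HL_exponent_ge:
  fixes m :: nat and p :: real
  assumes "m \<ge> 2" and "2 * real m \<le> p"
  shows "real m / 16 \<le> (real m * p + p - 6 * real m + 4) / (4 * p) * ((real m - 1) / real m)"
proof -
  define x where "x = real m"
  have x: "x \<ge> 2" and p: "p > 0" "2 * x \<le> p"
    using assms by (auto simp: x_def)
  \<comment> \<open>This is the next inequality with denominators cleared, an equality at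
    \<open>x = 2\<close>. The second factor is \<open>3 * x * (x - 2) + 4\<close>.\<close>
  have "0 \<le> (x - 2) * (3 * x\<^sup>2 - 6 * x + 4)"
    using x by (intro mult_nonneg_nonneg) (auto simp: power2_eq_square intro: order_trans[OF _ add_increasing2])
  then have "x / 16 \<le> (x\<^sup>2 - 2 * x + 2) / (4 * x) * ((x - 1) / x)"
    using x by (simp add: field_simps power2_eq_square)
  \<comment> \<open>The right-hand side increases with \<open>p\<close>, and the left-hand side is
    its value at the endpoint \<open>p = 2 * x\<close>. Cross-multiplying, the difference is
    \<open>(3 * x - 2) * (p - 2 * x)\<close>.\<close>
  also have "\<dots> \<le> (x * p + p - 6 * x + 4) / (4 * p) * ((x - 1) / x)"
  proof (rule mult_right_mono)
    have "0 \<le> (3 * x - 2) * (p - 2 * x)"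
      using x p by (intro mult_nonneg_nonneg) auto
    then show "(x\<^sup>2 - 2 * x + 2) / (4 * x) \<le> (x * p + p - 6 * x + 4) / (4 * p)"
      using x p by (simp add: field_simps power2_eq_square)
  qed (use x in auto)
  finally show ?thesis
    by (simp add: x_def)
qed

theorem theorem3p1:
  fixes m :: nat and p :: real
  assumes "m \<ge> 2" and "2 * real m \<le> p"
  shows "root 16 2 ^ m
           \<le> 2 powr ((real m * p + p - 6 * real m + 4) / (4 * p) * ((real m - 1) / real m))
         \<and> ereal (2 powr ((real m * p + p - 6 * real m + 4) / (4 * p) * ((real m - 1) / real m)))
           \<le> HL_pol_const m p"
proof
  have "root 16 2 ^ m = 2 powr (real m / 16)"
    by (simp add: root_powr_inverse powr_powr flip: powr_realpow)
  also have "\<dots> \<le> 2 powr ((real m * p + p - 6 * real m + 4) / (4 * p) * ((real m - 1) / real m))"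
    using HL_exponent_ge[OF assms] by (rule powr_mono) simp
  finally show "root 16 2 ^ m
      \<le> 2 powr ((real m * p + p - 6 * real m + 4) / (4 * p) * ((real m - 1) / real m))" .
next
  have "p > 0"
    using assms by linarith
  have "2 powr ((real m * p + p - 6 * real m + 4) / (4 * p) * ((real m - 1) / real m)) \<le> H"
    if "is_HL_const m p H" for H
  proof -
    have "2 powr ((real m * p + p - 6 * real m + 4) / (4 * p) * ((real m - 1) / real m))
        \<le> 2 powr (real (m div 2) * ((real m * p + p - 2 * real m) / (2 * real m * p)))"
      using HL_exponent_le[OF assms] by (rule powr_mono) simp
    also have "\<dots> \<le> H"
      by (intro HL_const_ge that \<open>p > 0\<close>) simp
    finally show ?thesis .
  qed
  \<comment> \<open>A lower bound for every admissible \<open>H\<close> bounds the infimum, which in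
    \<open>ereal\<close> is infinity for an empty set.\<close>
  then show "ereal (2 powr ((real m * p + p - 6 * real m + 4) / (4 * p) * ((real m - 1) / real m)))
      \<le> HL_pol_const m p"
    unfolding HL_pol_const_def by (auto intro!: Inf_greatest)
qed

end
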